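(* As $k\to\infty$, $$|E_k|\le \exp\left((2\log2+o(1))\frac{\log k}{\log\log k}\right)=k^{o(1)}.$$ More precisely, put $D_k:=\max_{1\le n<k^2}\tau(n)$. Then every active deficit $j$ at level $k$ and every corresponding overshoot $r=\tau(k^2-j)-j\in E_k$ satisfy $j\le D_k$ and $r\le D_k$, and $$D_k\le \exp\left((2\log2+o(1))\frac{\log k}{\log\log k}\right)\qquad(k\to\infty).$$
   Context: $\tau(n)$ is the number of positive divisors of $n$; $\log$ is the natural logarithm. For $k\ge2$, an active deficit at level $k$ is an integer $j$ with $1\le j\le 2k-2$ and $\tau(k^2-j)\ge j$, and the exit set is $$E_k=\{\tau(k^2-j)-j:\ 1\le j\le 2k-2,\ \tau(k^2-j)\ge j\}.$$ *)

theory Defs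
  imports Complex_Main
begin

definition tau :: "nat \<Rightarrow> nat" where
  "tau n = card {d. d dvd n}"

text \<open>
  Deficits are positive integers, hence of type \<^typ>\<open>nat\<close>. For \<open>k \<ge> 2\<close> the natural-number
  subtractions here and in \<open>exit_set\<close> never truncate: \<open>j \<le> 2 * k - 2 < k\<^sup>2\<close> and
  \<open>j \<le> tau (k\<^sup>2 - j)\<close>.
\<close>

definition active_deficit :: "nat \<Rightarrow> nat \<Rightarrow> bool" where
  "active_deficit k j \<longleftrightarrow> 1 \<le> j \<and> j \<le> 2 * k - 2 \<and> j \<le> tau (k\<^sup>2 - j)"

definition exit_set :: "nat \<Rightarrow> nat set" where
  "exit_set k = {tau (k\<^sup>2 - j) - j | j. active_deficit k j}"

definition max_tau :: "nat \<Rightarrow> nat" where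
  "max_tau k = Max (tau ` {1..<k\<^sup>2})"

text \<open>So \<open>card (exit_set k)\<close> is a genuine cardinality.\<close>

lemma finite_exit_set: "finite (exit_set k)"
proof -
  have "exit_set k \<subseteq> (\<lambda>j. tau (k\<^sup>2 - j) - j) ` {..2 * k - 2}"
    by (auto simp: exit_set_def active_deficit_def)
  then show ?thesis
    by (rule finite_subset) simp
qed

end

theory Submission
  imports Defs
    "HOL-Computational_Algebra.Primes"
    "HOL-Real_Asymp.Real_Asymp"
begin

text \<open>
  Overshoots and active deficits are both dominated by a single divisor count
  \<open>tau (k\<^sup>2 - j)\<close>, and \<open>j \<ge> 1\<close> leaves only the overshoots \<open>0, \<dots>, D - 1\<close>, where \<open>D = max_tau k\<close>;
  hence \<open>card (exit_set k) \<le> D\<close>, and everything reduces to bounding \<open>D\<close>.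

  That bound is Wigert's theorem.  Fix \<open>\<delta> > 0\<close> and compare \<open>tau n\<close>, which is at
  most the product of the \<open>a + 1\<close> over the prime powers \<open>p ^ a\<close> exactly dividing \<open>n\<close>, with \<open>n powr \<delta>\<close>, prime by prime.  A prime
  \<open>p \<ge> 2 powr (1 / \<delta>)\<close> contributes \<open>(a + 1) / (p ^ a) powr \<delta> \<le> (a + 1) / 2 ^ a \<le> 1\<close>, and any
  smaller prime at most \<open>1 + 1 / (\<delta> * ln 2)\<close>.  There are at most \<open>2 powr (1 / \<delta>)\<close> smaller primes,
  which gives \<open>tau_le_exp\<close>.

  For \<open>n < k\<^sup>2\<close> put \<open>L = ln (ln k)\<close>.  The choice \<open>\<delta> = ln 2 / L\<close> would give the right main term
  \<open>2 * ln 2 * ln k / L\<close>, but then \<open>2 powr (1 / \<delta>) = ln k\<close> small primes are too many.  Enlarging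
  \<open>\<delta>\<close> to \<open>ln 2 / (L - 3 * ln L)\<close> keeps the main term asymptotically and cuts their number to
  \<open>ln k / L ^ 3\<close>, whose contribution to the exponent is \<open>O(ln k * ln L / L ^ 3)\<close>, hence negligible.
\<close>

section \<open>The divisor function and prime powers\<close>

text \<open>
  Every divisor of \<open>a * b\<close> is a divisor of \<open>a\<close> times a divisor of \<open>b\<close>.
\<close>

lemma tau_mult_le:
  assumes "a > 0" "b > 0"
  shows "tau (a * b) \<le> tau a * tau b"
proof -
  have fin: "finite {d. d dvd a}" "finite {d. d dvd b}"
    using assms by auto
  have "{d. d dvd a * b} \<subseteq> (\<lambda>(x, y). x * y) ` ({d. d dvd a} \<times> {d. d dvd b})"
  proof
    fix d assume "d \<in> {d. d dvd a * b}"
    then obtain x y where "d = x * y" "x dvd a" "y dvd b"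
      using division_decomp[of d a b] by auto
    then show "d \<in> (\<lambda>(x, y). x * y) ` ({d. d dvd a} \<times> {d. d dvd b})"
      by (intro image_eqI[of _ _ "(x, y)"]) auto
  qed
  then have "card {d. d dvd a * b} \<le> card ({d. d dvd a} \<times> {d. d dvd b})"
    using fin by (meson card_image_le card_mono finite_SigmaI finite_imageI le_trans)
  then show ?thesis
    by (simp add: tau_def card_cartesian_product)
qed

lemma tau_prod_le:
  assumes "finite A" "\<And>x. x \<in> A \<Longrightarrow> f x > 0"
  shows "tau (\<Prod>x\<in>A. f x) \<le> (\<Prod>x\<in>A. tau (f x))"
  using assms
proof (induction A rule: finite_induct)
  case empty
  then show ?case by (simp add: tau_def)
next
  case (insert x A)
  have "tau (f x * prod f A) \<le> tau (f x) * tau (prod f A)"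
    using insert by (intro tau_mult_le) (auto intro: prod_pos)
  also have "\<dots> \<le> tau (f x) * (\<Prod>x\<in>A. tau (f x))"
    using insert by simp
  finally show ?case using insert by simp
qed

lemma tau_prime_power_le:
  assumes "prime p"
  shows "tau (p ^ a) \<le> a + 1"
proof -
  have "{d. d dvd p ^ a} \<subseteq> (\<lambda>i. p ^ i) ` {..a}"
    using divides_primepow_nat[OF assms] by auto
  then have "card {d. d dvd p ^ a} \<le> card {..a}"
    by (meson card_image_le card_mono finite_atMost finite_imageI le_trans)
  then show ?thesis by (simp add: tau_def)
qed

lemma tau_le_prod_multiplicity:
  assumes "n > 0"
  shows "tau n \<le> (\<Prod>p\<in>prime_factors n. multiplicity p n + 1)"
proof -
  have "tau n = tau (\<Prod>p\<in>prime_factors n. p ^ multiplicity p n)"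
    using prime_factorization_nat[OF assms] by simp
  also have "\<dots> \<le> (\<Prod>p\<in>prime_factors n. tau (p ^ multiplicity p n))"
    by (intro tau_prod_le) (auto simp: in_prime_factors_iff prime_gt_0_nat)
  also have "\<dots> \<le> (\<Prod>p\<in>prime_factors n. multiplicity p n + 1)"
    by (intro prod_mono conjI tau_prime_power_le) auto
  finally show ?thesis .
qed

section \<open>Wigert's bound with a free parameter\<close>

text \<open>
  Since \<open>2 powr (a * \<delta>) = exp (a * \<delta> * ln 2) \<ge> 1 + a * \<delta> * ln 2\<close>, the constant
  \<open>1 + 1 / (\<delta> * ln 2)\<close> absorbs \<open>a + 1\<close> uniformly in \<open>a\<close>.
\<close>

lemma Suc_le_const_mult_powr:
  fixes \<delta> :: real
  assumes "\<delta> > 0" "p \<ge> 2"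
  shows "real (a + 1) \<le> (1 + 1 / (\<delta> * ln 2)) * real (p ^ a) powr \<delta>"
proof -
  define c where "c = \<delta> * ln 2"
  have c: "c > 0" using assms by (simp add: c_def)
  have "1 + real a * c \<le> exp (real a * c)"
    by (rule exp_ge_add_one_self)
  also have "\<dots> = real (2 ^ a) powr \<delta>"
    by (simp add: powr_def ln_realpow c_def mult_ac)
  also have "\<dots> \<le> real (p ^ a) powr \<delta>"
    using assms by (intro powr_mono2) (auto intro: power_mono)
  finally have *: "1 + real a * c \<le> real (p ^ a) powr \<delta>" .
  have "real (a + 1) \<le> (1 + 1 / c) * (1 + real a * c)"
    using c by (simp add: field_simps)
  also have "\<dots> \<le> (1 + 1 / c) * real (p ^ a) powr \<delta>"
    using * c by (intro mult_left_mono) auto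
  finally show ?thesis by (simp add: c_def)
qed

lemma Suc_le_powr:
  fixes \<delta> :: real
  assumes "\<delta> > 0" "real p \<ge> 2 powr (1 / \<delta>)"
  shows "real (a + 1) \<le> real (p ^ a) powr \<delta>"
proof -
  have p: "real p > 0"
    using assms(2) by (rule less_le_trans[rotated]) simp
  have "2 = (2 powr (1 / \<delta>)) powr \<delta>"
    using assms by (simp add: powr_powr)
  also have "\<dots> \<le> real p powr \<delta>"
    using assms by (intro powr_mono2) auto
  finally have "2 ^ a \<le> (real p powr \<delta>) ^ a"
    by (intro power_mono) auto
  also have "\<dots> = real (p ^ a) powr \<delta>"
    using p by (simp add: powr_def ln_realpow exp_of_nat_mult[symmetric] mult_ac)
  finally have "2 ^ a \<le> real (p ^ a) powr \<delta>" .
  moreover have "real (a + 1) \<le> 2 ^ a"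
    using less_exp[of a] by (metis Suc_eq_plus1 Suc_leI of_nat_le_iff of_nat_numeral of_nat_power)
  ultimately show ?thesis by linarith
qed

text \<open>
  Comparison of \<open>tau n\<close> with \<open>n powr \<delta>\<close> factor by factor; only the primes below
  \<open>2 powr (1 / \<delta>)\<close> cost a constant, and they are counted trivially as integers.
\<close>

lemma tau_le_exp:
  fixes \<delta> :: real
  assumes "n > 0" "\<delta> > 0"
  shows "real (tau n) \<le> exp (\<delta> * ln (real n) + 2 powr (1 / \<delta>) * ln (1 + 1 / (\<delta> * ln 2)))"
proof -
  define B where "B = 2 powr (1 / \<delta>)"
  define K where "K = 1 + 1 / (\<delta> * ln 2)"
  define S where "S = {p \<in> prime_factors n. real p < B}"
  have K: "K \<ge> 1" using assms by (simp add: K_def)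
  have B: "B > 0" by (simp add: B_def)
  have factor: "real (multiplicity p n + 1)
      \<le> (if real p < B then K else 1) * real (p ^ multiplicity p n) powr \<delta>"
    if "p \<in> prime_factors n" for p
  proof -
    have "p \<ge> 2" using that by (auto simp: in_prime_factors_iff prime_ge_2_nat)
    then show ?thesis
      using Suc_le_const_mult_powr[OF assms(2), of p] Suc_le_powr[OF assms(2), of p]
      by (simp add: K_def B_def)
  qed
  have "S \<subseteq> {1..nat \<lfloor>B\<rfloor>}"
    using B by (auto simp: S_def in_prime_factors_iff le_nat_iff le_floor_iff prime_gt_0_nat
        Suc_leI)
  then have "card S \<le> nat \<lfloor>B\<rfloor>"
    using card_mono[of "{1..nat \<lfloor>B\<rfloor>}" S] by simp
  then have card_S: "real (card S) \<le> B"
    using B by linarith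
  have small: "(\<Prod>p\<in>prime_factors n. if real p < B then K else 1) = K ^ card S"
    by (simp add: prod.If_cases S_def Int_def)
  have "real (tau n) \<le> real (\<Prod>p\<in>prime_factors n. multiplicity p n + 1)"
    using tau_le_prod_multiplicity[OF assms(1)] by (simp only: of_nat_le_iff)
  also have "\<dots> = (\<Prod>p\<in>prime_factors n. real (multiplicity p n + 1))"
    by simp
  also have "\<dots> \<le> (\<Prod>p\<in>prime_factors n.
      (if real p < B then K else 1) * real (p ^ multiplicity p n) powr \<delta>)"
    using factor by (intro prod_mono) auto
  also have "\<dots> = K ^ card S * (\<Prod>p\<in>prime_factors n. real (p ^ multiplicity p n) powr \<delta>)"
    by (simp only: prod.distrib small)
  also have "(\<Prod>p\<in>prime_factors n. real (p ^ multiplicity p n) powr \<delta>)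
      = real (\<Prod>p\<in>prime_factors n. p ^ multiplicity p n) powr \<delta>"
    by (simp only: of_nat_prod prod_powr_distrib of_nat_0_le_iff)
  also have "(\<Prod>p\<in>prime_factors n. p ^ multiplicity p n) = n"
    using prime_factorization_nat[OF assms(1)] by simp
  also have "K ^ card S = exp (real (card S) * ln K)"
    using K by (simp add: exp_of_nat_mult)
  also have "real n powr \<delta> = exp (\<delta> * ln (real n))"
    using assms by (simp add: powr_def)
  also have "exp (real (card S) * ln K) * exp (\<delta> * ln (real n))
      \<le> exp (B * ln K) * exp (\<delta> * ln (real n))"
    using card_S K by (intro mult_right_mono) (auto intro: mult_right_mono)
  finally show ?thesis
    by (simp add: B_def K_def exp_add mult_ac)
qed

section \<open>Active deficits and the maximal divisor count\<close>

lemma tau_le_max_tau: "1 \<le> n \<Longrightarrow> n < k\<^sup>2 \<Longrightarrow> tau n \<le> max_tau k"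
  unfolding max_tau_def by (intro Max_ge) auto

lemma max_tau_attained:
  assumes "k \<ge> 2"
  obtains n where "1 \<le> n" "n < k\<^sup>2" "max_tau k = tau n"
proof -
  have "1 < k\<^sup>2" using assms one_less_power[of k 2] by simp
  then have "tau ` {1..<k\<^sup>2} \<noteq> {}" by auto
  then have "max_tau k \<in> tau ` {1..<k\<^sup>2}"
    unfolding max_tau_def by (intro Max_in) auto
  then show ?thesis using that by auto
qed

lemma active_deficit_tau_le_max_tau:
  assumes "k \<ge> 2" "active_deficit k j"
  shows "tau (k\<^sup>2 - j) \<le> max_tau k"
proof -
  have "2 * k \<le> k\<^sup>2" using assms(1) by (simp add: power2_eq_square)
  then show ?thesis
    using assms by (intro tau_le_max_tau) (auto simp: active_deficit_def)
qed

lemma card_exit_set_le_max_tau: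
  assumes "k \<ge> 2"
  shows "card (exit_set k) \<le> max_tau k"
proof -
  have "exit_set k \<subseteq> {..<max_tau k}"
  proof
    fix r assume "r \<in> exit_set k"
    then obtain j where j: "active_deficit k j" and r: "r = tau (k\<^sup>2 - j) - j"
      by (auto simp: exit_set_def)
    have "1 \<le> j" "j \<le> tau (k\<^sup>2 - j)" using j by (auto simp: active_deficit_def)
    then show "r \<in> {..<max_tau k}"
      using active_deficit_tau_le_max_tau[OF assms j] r by simp
  qed
  then show ?thesis
    using card_mono[of "{..<max_tau k}" "exit_set k"] by simp
qed

lemma max_tau_le_exp:
  fixes \<delta> :: real
  assumes "k \<ge> 2" "\<delta> > 0"
  shows "real (max_tau k)
    \<le> exp (2 * \<delta> * ln (real k) + 2 powr (1 / \<delta>) * ln (1 + 1 / (\<delta> * ln 2)))"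
proof -
  obtain n where n: "1 \<le> n" "n < k\<^sup>2" "max_tau k = tau n"
    using max_tau_attained[OF assms(1)] .
  have "ln (real n) \<le> ln (real (k\<^sup>2))"
    using n assms by (subst ln_le_cancel_iff) (auto simp del: of_nat_power)
  also have "\<dots> = 2 * ln (real k)"
    using assms by (simp add: ln_realpow)
  finally have "\<delta> * ln (real n) \<le> 2 * \<delta> * ln (real k)"
    using assms by simp
  then show ?thesis
    using tau_le_exp[of n \<delta>] n assms by (auto elim!: order_trans)
qed

section \<open>Choice of the parameter\<close>

text \<open>
  The error term, in terms of \<open>L = ln (ln k)\<close> and \<open>M = L - 3 * ln L\<close>, that results from
  \<open>\<delta> = ln 2 / M\<close>: the first summand is the loss from replacing \<open>L\<close> by \<open>M\<close> in the main term, the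
  second is the contribution of the \<open>exp M = ln k / L ^ 3\<close> small primes, relative to \<open>ln k / L\<close>.
\<close>

definition wigert_error :: "nat \<Rightarrow> real" where
  "wigert_error k = (let L = ln (ln (real k)); M = L - 3 * ln L in
     2 * ln 2 * (L / M - 1) + ln (1 + M / (ln 2)\<^sup>2) / L\<^sup>2)"

lemma wigert_error_tendsto_0: "wigert_error \<longlonglongrightarrow> 0"
  unfolding wigert_error_def Let_def by real_asymp

lemma max_tau_le_wigert:
  "\<forall>\<^sub>F k in sequentially.
     real (max_tau k) \<le> exp ((2 * ln 2 + wigert_error k) * (ln (real k) / ln (ln (real k))))"
proof -
  have "\<forall>\<^sub>F k::nat in sequentially. ln (ln (real k)) > 0"
    "\<forall>\<^sub>F k::nat in sequentially. ln (ln (real k)) - 3 * ln (ln (ln (real k))) > 0"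
    by real_asymp+
  then show ?thesis
    using eventually_ge_at_top[of 2]
  proof eventually_elim
    case (elim k)
    define L where "L = ln (ln (real k))"
    define M where "M = L - 3 * ln L"
    define \<delta> where "\<delta> = ln 2 / M"
    have L: "L > 0" and M: "M > 0" using elim by (auto simp: L_def M_def)
    have \<delta>: "\<delta> > 0" using M by (simp add: \<delta>_def)
    have "ln (real k) > 0" using elim(3) by simp
    have "2 powr (1 / \<delta>) = exp M"
      by (simp add: powr_def \<delta>_def)
    also have "\<dots> = exp L / exp (3 * ln L)"
      by (simp add: M_def exp_diff)
    also have "exp (3 * ln L) = L ^ 3"
      using L exp_of_nat_mult[of 3 "ln L"] by simp
    also have "exp L = ln (real k)"
      using \<open>ln (real k) > 0\<close> by (simp add: L_def)
    finally have small: "2 powr (1 / \<delta>) = ln (real k) / L ^ 3" .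
    have const: "1 + 1 / (\<delta> * ln 2) = 1 + M / (ln 2)\<^sup>2"
      by (simp add: \<delta>_def power2_eq_square)
    have "2 * \<delta> * ln (real k) + 2 powr (1 / \<delta>) * ln (1 + 1 / (\<delta> * ln 2))
        = (2 * ln 2 + (2 * ln 2 * (L / M - 1) + ln (1 + M / (ln 2)\<^sup>2) / L\<^sup>2)) * (ln (real k) / L)"
      unfolding small const unfolding \<delta>_def
      using L M by (simp add: field_simps power2_eq_square power3_eq_cube)
    also have "\<dots> = (2 * ln 2 + wigert_error k) * (ln (real k) / L)"
      by (simp add: wigert_error_def Let_def L_def M_def)
    finally show ?case
      using max_tau_le_exp[OF elim(3) \<delta>] by (simp add: L_def)
  qed
qed

theorem proposition7p1:
  shows "(\<exists>\<epsilon> \<delta> :: nat \<Rightarrow> real. \<epsilon> \<longlonglongrightarrow> 0 \<and> \<delta> \<longlonglongrightarrow> 0 \<and>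
           (\<forall>\<^sub>F k in sequentially.
              real (card (exit_set k)) \<le> exp ((2 * ln 2 + \<epsilon> k) * (ln (real k) / ln (ln (real k)))) \<and>
              exp ((2 * ln 2 + \<epsilon> k) * (ln (real k) / ln (ln (real k)))) = real k powr \<delta> k))
       \<and> (\<forall>k j r :: nat. k \<ge> 2 \<and> active_deficit k j \<and> r = tau (k\<^sup>2 - j) - j \<longrightarrow>
              j \<le> max_tau k \<and> r \<le> max_tau k)
       \<and> (\<exists>\<epsilon> :: nat \<Rightarrow> real. \<epsilon> \<longlonglongrightarrow> 0 \<and>
           (\<forall>\<^sub>F k in sequentially.
              real (max_tau k) \<le> exp ((2 * ln 2 + \<epsilon> k) * (ln (real k) / ln (ln (real k))))))"
proof (intro conjI)
  define \<delta> where "\<delta> = (\<lambda>k. (2 * ln 2 + wigert_error k) * (1 / ln (ln (real k))))"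
  have "(\<lambda>k. 1 / ln (ln (real k))) \<longlonglongrightarrow> 0" by real_asymp
  then have "\<delta> \<longlonglongrightarrow> (2 * ln 2 + 0) * 0"
    unfolding \<delta>_def by (intro tendsto_mult tendsto_add tendsto_const wigert_error_tendsto_0)
  then have \<delta>: "\<delta> \<longlonglongrightarrow> 0" by simp
  have "\<forall>\<^sub>F k in sequentially.
      real (card (exit_set k))
        \<le> exp ((2 * ln 2 + wigert_error k) * (ln (real k) / ln (ln (real k)))) \<and>
      exp ((2 * ln 2 + wigert_error k) * (ln (real k) / ln (ln (real k)))) = real k powr \<delta> k"
    using max_tau_le_wigert eventually_ge_at_top[of 2]
  proof eventually_elim
    case (elim k)
    have "real (card (exit_set k)) \<le> real (max_tau k)"
      using card_exit_set_le_max_tau[OF elim(2)] by simp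
    then show ?case
      using elim by (auto simp: powr_def \<delta>_def)
  qed
  with \<delta> wigert_error_tendsto_0
  show "\<exists>\<epsilon> \<delta> :: nat \<Rightarrow> real. \<epsilon> \<longlonglongrightarrow> 0 \<and> \<delta> \<longlonglongrightarrow> 0 \<and>
      (\<forall>\<^sub>F k in sequentially.
         real (card (exit_set k)) \<le> exp ((2 * ln 2 + \<epsilon> k) * (ln (real k) / ln (ln (real k)))) \<and>
         exp ((2 * ln 2 + \<epsilon> k) * (ln (real k) / ln (ln (real k)))) = real k powr \<delta> k)"
    by blast
next
  show "\<forall>k j r :: nat. k \<ge> 2 \<and> active_deficit k j \<and> r = tau (k\<^sup>2 - j) - j \<longrightarrow>
      j \<le> max_tau k \<and> r \<le> max_tau k"
  proof (intro allI impI)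
    fix k j r :: nat
    assume *: "k \<ge> 2 \<and> active_deficit k j \<and> r = tau (k\<^sup>2 - j) - j"
    then have "tau (k\<^sup>2 - j) \<le> max_tau k"
      by (simp add: active_deficit_tau_le_max_tau)
    moreover have "j \<le> tau (k\<^sup>2 - j)"
      using * by (simp add: active_deficit_def)
    ultimately show "j \<le> max_tau k \<and> r \<le> max_tau k"
      using * by auto
  qed
next
  show "\<exists>\<epsilon> :: nat \<Rightarrow> real. \<epsilon> \<longlonglongrightarrow> 0 \<and>
      (\<forall>\<^sub>F k in sequentially.
         real (max_tau k) \<le> exp ((2 * ln 2 + \<epsilon> k) * (ln (real k) / ln (ln (real k)))))"
    using wigert_error_tendsto_0 max_tau_le_wigert by blast
qed

end
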